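(* Let $\Omega$ be a simply connected topological space, and let $\mathcal{U}$ be a covering of $\Omega$ consisting of path-connected open subsets of $\Omega$. Let $\mathcal{I} := \{(U,V)\in\mathcal{U}\times\mathcal{U} : U\cap V\neq\varnothing\}$, and let $d\colon\mathcal{I}\to\mathbb{K}$, $(U,V)\mapsto d_{UV}$, be a mapping satisfying $$d_{UV}=-d_{VU}\quad\text{for all }(U,V)\in\mathcal{I},$$ $$d_{UW}=d_{UV}+d_{VW}\quad\text{for all }U,V,W\in\mathcal{U}\text{ with }U\cap V\cap W\neq\varnothing.$$ Then there exists a mapping $C\colon\mathcal{U}\to\mathbb{K}$, $U\mapsto C_U$, such that $d_{UV}=C_V-C_U$ for all $(U,V)\in\mathcal{I}$.
   Context: $\mathbb{K}$ denotes the field of real or complex numbers ($\mathbb{K}=\mathbb{R}$ or $\mathbb{K}=\mathbb{C}$). A mapping $d\colon\mathcal{I}\to\mathbb{K}$ is called a coupling, and a mapping $C\colon\mathcal{U}\to\mathbb{K}$ with $d_{UV}=C_V-C_U$ for all $(U,V)\in\mathcal{I}$ is called a primitive of $d$. Arguments of $d$ and $C$ are written as subscripts. Simply connected has its standard meaning (path-connected, and any two paths with the same endpoints are homotopic with fixed endpoints). *)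

theory Defs
  imports "HOL-Analysis.Analysis"
begin

text \<open>
  The library's \<^const>\<open>simply_connected\<close> concerns subsets of a topological-space type and is
  phrased via free homotopies of loops; this is the definition by paths with common endpoints,
  for an abstract topology. The predicate passed to \<^const>\<open>homotopic_with\<close> keeps the endpoints
  fixed throughout the homotopy.
\<close>

definition simply_connected_space :: "'a topology \<Rightarrow> bool" where
  "simply_connected_space X \<longleftrightarrow>
     path_connected_space X \<and>
     (\<forall>p q. pathin X p \<and> pathin X q \<and> p 0 = q 0 \<and> p 1 = q 1 \<longrightarrow>
        homotopic_with (\<lambda>r. r 0 = p 0 \<and> r 1 = p 1) (top_of_set {0..1}) X p q)"

definition overlaps :: "'a set set \<Rightarrow> ('a set \<times> 'a set) set" where
  "overlaps \<U> = {(U, V) \<in> \<U> \<times> \<U>. U \<inter> V \<noteq> {}}"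

text \<open>
  A coupling \<open>d\<close> is a mapping on \<^term>\<open>overlaps \<U>\<close> and a primitive is a mapping on \<open>\<U>\<close>; as HOL
  functions are total, their values elsewhere are arbitrary and play no role below.
\<close>

definition antisymmetric_coupling ::
    "'a set set \<Rightarrow> ('a set \<times> 'a set \<Rightarrow> 'k::ab_group_add) \<Rightarrow> bool" where
  "antisymmetric_coupling \<U> d \<longleftrightarrow> (\<forall>(U, V) \<in> overlaps \<U>. d (U, V) = - d (V, U))"

definition additive_coupling ::
    "'a set set \<Rightarrow> ('a set \<times> 'a set \<Rightarrow> 'k::ab_group_add) \<Rightarrow> bool" where
  "additive_coupling \<U> d \<longleftrightarrow>
     (\<forall>U\<in>\<U>. \<forall>V\<in>\<U>. \<forall>W\<in>\<U>. U \<inter> V \<inter> W \<noteq> {} \<longrightarrow> d (U, W) = d (U, V) + d (V, W))"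

definition is_primitive ::
    "'a set set \<Rightarrow> ('a set \<times> 'a set \<Rightarrow> 'k::ab_group_add) \<Rightarrow> ('a set \<Rightarrow> 'k) \<Rightarrow> bool" where
  "is_primitive \<U> d C \<longleftrightarrow> (\<forall>(U, V) \<in> overlaps \<U>. d (U, V) = C V - C U)"

end

theory Submission
  imports Defs
begin

text \<open>
  A coupling induces a function \<open>g\<close> on pairs of points lying in a common member of the covering
  that satisfies \<open>g x y + g y z = g x z\<close> locally; a primitive of the coupling amounts to a
  potential of \<open>g\<close>. Pulled back along a map from a compact convex set, \<open>g\<close> has a potential at
  small scale, obtained by summing along segments from a base point. Applied to the unit square,
  this shows that the increment of a potential along a path depends only on the homotopy class of
  the path, so in a simply connected space the increments define a global potential.
\<close>

section \<open>Cocycles on points and their potentials at small scale\<close>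

definition cocycle_on :: "'a set set \<Rightarrow> ('a \<Rightarrow> 'a \<Rightarrow> 'k::ab_group_add) \<Rightarrow> bool" where
  "cocycle_on \<U> g \<longleftrightarrow> (\<forall>W\<in>\<U>. \<forall>x\<in>W. \<forall>y\<in>W. \<forall>z\<in>W. g x y + g y z = g x z)"

text \<open>One \<open>\<epsilon>\<close> serves all of \<open>S\<close>, so that an interval can be
  crossed in finitely many equal steps shorter than \<open>\<epsilon>\<close>.\<close>

definition local_potential ::
    "('a \<Rightarrow> 'a \<Rightarrow> 'k::ab_group_add) \<Rightarrow> 'b::metric_space set \<Rightarrow> ('b \<Rightarrow> 'a) \<Rightarrow> ('b \<Rightarrow> 'k) \<Rightarrow> bool" where
  "local_potential g S h F \<longleftrightarrow>
     (\<exists>\<epsilon>>0. \<forall>s\<in>S. \<forall>t\<in>S. dist s t < \<epsilon> \<longrightarrow> F t - F s = g (h s) (h t))"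

lemma cocycle_onD:
  "cocycle_on \<U> g \<Longrightarrow> W \<in> \<U> \<Longrightarrow> x \<in> W \<Longrightarrow> y \<in> W \<Longrightarrow> z \<in> W \<Longrightarrow> g x y + g y z = g x z"
  by (auto simp: cocycle_on_def)

lemma cocycle_on_refl:
  assumes "cocycle_on \<U> g" "W \<in> \<U>" "x \<in> W"
  shows "g x x = 0"
  using cocycle_onD[OF assms(1,2,3,3,3)] by simp

lemma Lebesgue_number_preimage:
  fixes S :: "'b::metric_space set"
  assumes S: "compact S" and h: "continuous_map (top_of_set S) X h"
    and cov: "\<Union>\<U> = topspace X" and op: "\<And>U. U \<in> \<U> \<Longrightarrow> openin X U"
  obtains \<epsilon> where "\<epsilon> > 0" "\<And>x. x \<in> S \<Longrightarrow> \<exists>W\<in>\<U>. \<forall>y\<in>S. dist x y < \<epsilon> \<longrightarrow> h y \<in> W"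
proof -
  \<comment> \<open>Preimages of members are open only relative to \<open>S\<close>;
    \<open>\<V>\<close> consists of open sets of the ambient space, to which
    \<open>Heine_Borel_lemma\<close> applies.\<close>
  define \<V> where "\<V> = {T. open T \<and> (\<exists>W\<in>\<U>. \<forall>y\<in>S \<inter> T. h y \<in> W)}"
  have "S \<subseteq> \<Union>\<V>"
  proof
    fix x assume x: "x \<in> S"
    then have "h x \<in> topspace X" using h by (auto simp: continuous_map_def)
    then obtain W where W: "W \<in> \<U>" "h x \<in> W" using cov by auto
    have "openin (top_of_set S) {y \<in> S. h y \<in> W}"
      using openin_continuous_map_preimage[OF h op[OF W(1)]] by simp
    then obtain T where T: "open T" "{y \<in> S. h y \<in> W} = S \<inter> T"
      by (auto simp: openin_open)
    then have "T \<in> \<V>" using W(1) unfolding \<V>_def by blast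
    moreover have "x \<in> T" using T x W(2) by auto
    ultimately show "x \<in> \<Union>\<V>" by blast
  qed
  then obtain \<epsilon> where \<epsilon>: "0 < \<epsilon>" "\<And>x. x \<in> S \<Longrightarrow> \<exists>G\<in>\<V>. ball x \<epsilon> \<subseteq> G"
    using Heine_Borel_lemma[OF S, of \<V>] unfolding \<V>_def by blast
  have "\<exists>W\<in>\<U>. \<forall>y\<in>S. dist x y < \<epsilon> \<longrightarrow> h y \<in> W" if x: "x \<in> S" for x
  proof -
    obtain T W where "ball x \<epsilon> \<subseteq> T" "W \<in> \<U>" "\<forall>y\<in>S \<inter> T. h y \<in> W"
      using \<epsilon>(2)[OF x] unfolding \<V>_def by blast
    then show ?thesis by (metis IntI mem_ball subsetD)
  qed
  with \<epsilon>(1) show ?thesis by (rule that)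
qed

text \<open>\<open>F x\<close> sums \<open>g\<close> over \<open>n\<close> equal steps of the
  segment from \<open>a\<close> to \<open>x\<close>. For nearby \<open>x\<close> and
  \<open>y\<close> the two segments form a ladder of small quadrilaterals; the cocycle identity on
  each turns the difference of the sums into a telescoping sum over the rungs.\<close>

lemma local_potential_exists:
  fixes S :: "'b::real_normed_vector set"
  assumes S: "compact S" "convex S" and h: "continuous_map (top_of_set S) X h"
    and cov: "\<Union>\<U> = topspace X" and op: "\<And>U. U \<in> \<U> \<Longrightarrow> openin X U"
    and g: "cocycle_on \<U> g"
  shows "\<exists>F. local_potential g S h F"
proof (cases "S = {}")
  case True
  then show ?thesis by (auto simp: local_potential_def intro: exI[of _ 1])
next
  case False
  then obtain a where a: "a \<in> S" by blast
  obtain \<epsilon> where \<epsilon>: "\<epsilon> > 0" "\<And>x. x \<in> S \<Longrightarrow> \<exists>W\<in>\<U>. \<forall>y\<in>S. dist x y < \<epsilon> \<longrightarrow> h y \<in> W"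
    using Lebesgue_number_preimage[OF S(1) h cov op] by metis
  define G where "G x y = g (h x) (h y)" for x y
  \<comment> \<open>The \<open>\<epsilon>\<close>-ball around \<open>x\<close> is mapped into one
    member, so only distances from \<open>x\<close> are restricted.\<close>
  have G: "G x y + G y z = G x z"
    if xyz: "x \<in> S" "y \<in> S" "z \<in> S" and "dist x y < \<epsilon>" "dist x z < \<epsilon>" for x y z
  proof -
    obtain W where "W \<in> \<U>" "\<forall>y\<in>S. dist x y < \<epsilon> \<longrightarrow> h y \<in> W"
      using \<epsilon>(2)[OF xyz(1)] by blast
    with that \<epsilon>(1) show ?thesis
      unfolding G_def by (intro cocycle_onD[OF g]) auto
  qed
  have Grefl: "G x x = 0" if x: "x \<in> S" for x
    using G[OF that that that] \<epsilon>(1) by simp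
  obtain B where B: "\<And>x. x \<in> S \<Longrightarrow> norm (x - a) \<le> B"
    using compact_imp_bounded[OF S(1)] unfolding bounded_any_center[where a=a]
    by (auto simp: dist_norm norm_minus_commute)
  \<comment> \<open>Segments from \<open>a\<close> have length at most \<open>B\<close>; this choice
    makes each step at most \<open>B / n < \<epsilon> / 2\<close>.\<close>
  obtain n :: nat where n: "2 * B / \<epsilon> < n" "n > 0"
    using reals_Archimedean2[of "max 0 (2 * B / \<epsilon>)"] by auto
  define q where "q x k = a + (real k / real n) *\<^sub>R (x - a)" for x :: 'b and k :: nat
  have q: "q x k \<in> S" if "x \<in> S" "k \<le> n" for x k
    using convexD_alt[OF S(2) a that(1), of "real k / real n"] that(2) n(2)
    by (simp add: q_def algebra_simps)
  have q0: "q x 0 = a" and qn: "q x n = x" for x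
    using n(2) by (simp_all add: q_def)
  have step: "dist (q x k) (q x (Suc k)) < \<epsilon> / 2" if "x \<in> S" for x k
  proof -
    have "q x k - q x (Suc k) = (- 1 / real n) *\<^sub>R (x - a)"
      by (simp add: q_def scaleR_diff_left[symmetric] diff_divide_distrib[symmetric])
    then have "dist (q x k) (q x (Suc k)) = norm (x - a) / n"
      by (simp add: dist_norm)
    also have "\<dots> \<le> B / n" using B[OF that] by (simp add: divide_right_mono)
    also have "\<dots> < \<epsilon> / 2" using n \<epsilon>(1) by (simp add: field_simps)
    finally show ?thesis .
  qed
  have across: "dist (q x k) (q y k) \<le> dist x y" if "k \<le> n" for x y k
  proof -
    have "q x k - q y k = (real k / real n) *\<^sub>R (x - y)"
      by (simp add: q_def algebra_simps)
    then have "dist (q x k) (q y k) = (real k / real n) * dist x y"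
      by (simp add: dist_norm)
    also have "\<dots> \<le> 1 * dist x y"
      using that n(2) by (intro mult_right_mono) auto
    finally show ?thesis by simp
  qed
  define F where "F x = (\<Sum>k<n. G (q x k) (q x (Suc k)))" for x
  have "F y - F x = G x y" if xy: "x \<in> S" "y \<in> S" "dist x y < \<epsilon> / 2" for x y
  proof -
    \<comment> \<open>Both ways around a quadrilateral give \<open>G ?u ?z\<close>. The scale
      \<open>\<epsilon> / 2\<close> for sides keeps the diagonal from \<open>?u\<close> to
      \<open>?z\<close> below \<open>\<epsilon>\<close>.\<close>
    have *: "G (q y k) (q y (Suc k)) - G (q x k) (q x (Suc k))
        = G (q x (Suc k)) (q y (Suc k)) - G (q x k) (q y k)" if "k < n" for k
    proof -
      let ?u = "q x k" and ?v = "q x (Suc k)" and ?w = "q y k" and ?z = "q y (Suc k)"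
      have "dist ?u ?v < \<epsilon> / 2" "dist ?u ?w < \<epsilon> / 2" "dist ?v ?z < \<epsilon> / 2"
        using step[OF xy(1)] across[of k x y] across[of "Suc k" x y] that xy(3) by force+
      moreover from this have "dist ?u ?z < \<epsilon>"
        using dist_triangle[of ?u ?z ?v] by linarith
      ultimately have "G ?u ?w + G ?w ?z = G ?u ?z" "G ?u ?v + G ?v ?z = G ?u ?z"
        using that xy \<epsilon>(1) by (intro G q; simp)+
      then show ?thesis by (simp add: algebra_simps)
    qed
    have "F y - F x = (\<Sum>k<n. G (q x (Suc k)) (q y (Suc k)) - G (q x k) (q y k))"
      unfolding F_def sum_subtractf[symmetric] using * by (intro sum.cong) auto
    also have "\<dots> = G x y - G a a"
      using sum_lessThan_telescope[of "\<lambda>k. G (q x k) (q y k)" n] by (simp add: q0 qn)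
    finally show ?thesis using Grefl[OF a] by simp
  qed
  then have "local_potential g S h F"
    unfolding local_potential_def G_def using \<epsilon>(1) by (intro exI[of _ "\<epsilon> / 2"]) auto
  then show ?thesis by blast
qed

section \<open>Increments along paths and their homotopy invariance\<close>

lemma local_potential_compose:
  assumes "local_potential g S h F" and "f ` T \<subseteq> S"
    and "\<And>s t. s \<in> T \<Longrightarrow> t \<in> T \<Longrightarrow> dist (f s) (f t) \<le> dist s t"
  shows "local_potential g T (h \<circ> f) (F \<circ> f)"
proof -
  obtain \<epsilon> where "\<epsilon> > 0" "\<And>s t. s \<in> S \<Longrightarrow> t \<in> S \<Longrightarrow> dist s t < \<epsilon> \<Longrightarrow> F t - F s = g (h s) (h t)"
    using assms(1) by (auto simp: local_potential_def)
  moreover have "dist (f s) (f t) < \<epsilon>" if "s \<in> T" "t \<in> T" "dist s t < \<epsilon>" for s t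
    using assms(3)[OF that(1,2)] that(3) by simp
  ultimately show ?thesis
    unfolding local_potential_def using assms(2)
    by (intro exI[of _ \<epsilon>]) (auto simp: image_subset_iff)
qed

text \<open>In steps of length \<open>1 / n\<close> below both scales, \<open>F\<close> and
  \<open>F'\<close> change by the same value of \<open>g\<close> each time.\<close>

lemma local_potential_increment_unique:
  fixes F F' :: "real \<Rightarrow> 'b::ab_group_add"
  assumes "local_potential g {0..1} p F" "local_potential g {0..1} p F'"
  shows "F 1 - F 0 = F' 1 - F' 0"
proof -
  obtain e1 e2 where e: "e1 > 0" "e2 > 0"
    and F: "\<And>s t. s \<in> {0..1} \<Longrightarrow> t \<in> {0..1} \<Longrightarrow> dist s t < e1 \<Longrightarrow> F t - F s = g (p s) (p t)"
    and F': "\<And>s t. s \<in> {0..1} \<Longrightarrow> t \<in> {0..1} \<Longrightarrow> dist s t < e2 \<Longrightarrow> F' t - F' s = g (p s) (p t)"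
    using assms unfolding local_potential_def by metis
  obtain n :: nat where n: "n > 0" "1 / real n < min e1 e2"
    using e nat_approx_posE[of "min e1 e2"] by (metis min_less_iff_conj zero_less_Suc)
  have "F (k / n) - F 0 = F' (k / n) - F' 0" if "k \<le> n" for k :: nat
    using that
  proof (induction k)
    case (Suc k)
    have d: "dist (k / n) (Suc k / n) = 1 / n"
      by (simp add: dist_real_def diff_divide_distrib[symmetric])
    have "F (Suc k / n) - F (k / n) = F' (Suc k / n) - F' (k / n)"
      using F[of "k / n" "Suc k / n"] F'[of "k / n" "Suc k / n"] d n Suc.prems by simp
    moreover have "F (k / n) - F 0 = F' (k / n) - F' 0" using Suc by simp
    moreover have "H (Suc k / n) - H 0 = (H (Suc k / n) - H (k / n)) + (H (k / n) - H 0)"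
      for H :: "real \<Rightarrow> 'b" by simp
    ultimately show ?case by metis
  qed simp
  from this[of n] n(1) show ?thesis by simp
qed

text \<open>The homotopy has a potential \<open>F\<close> on the unit square. Two opposite sides
  carry \<open>p\<close> and \<open>q\<close>; on the other two the homotopy is constant, so
  \<open>F\<close> has equal values at their ends.\<close>

lemma local_potential_increment_homotopic:
  assumes hom: "homotopic_with (\<lambda>r. r 0 = p 0 \<and> r 1 = p 1) (top_of_set {0..1::real}) X p q"
    and cov: "\<Union>\<U> = topspace X" and op: "\<And>U. U \<in> \<U> \<Longrightarrow> openin X U"
    and g: "cocycle_on \<U> g"
    and P: "local_potential g {0..1} p P" and Q: "local_potential g {0..1} q Q"
  shows "P 1 - P 0 = Q 1 - Q 0"
proof -
  let ?I = "{0..1::real}"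
  obtain h where h: "continuous_map (prod_topology (top_of_set ?I) (top_of_set ?I)) X h"
    and h0: "\<And>t. h (0, t) = p t" and h1: "\<And>t. h (1, t) = q t"
    and ends: "\<And>s. s \<in> ?I \<Longrightarrow> h (s, 0) = p 0 \<and> h (s, 1) = p 1"
    using hom unfolding homotopic_with_def by blast
  have h': "continuous_map (top_of_set (?I \<times> ?I)) X h" using h by simp
  obtain F where F: "local_potential g (?I \<times> ?I) h F"
    using local_potential_exists[OF _ _ h' cov op g] by (auto intro: compact_Times convex_Times)
  have edge: "local_potential g ?I (h \<circ> f) (F \<circ> f)"
    if "f ` ?I \<subseteq> ?I \<times> ?I" "\<And>s t. dist (f s) (f t) = dist s t" for f
    using local_potential_compose[OF F that(1)] that(2) by simp
  have [simp]: "h \<circ> Pair 0 = p" "h \<circ> Pair 1 = q" using h0 h1 by auto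
  have "local_potential g ?I p (F \<circ> Pair 0)" "local_potential g ?I q (F \<circ> Pair 1)"
    using edge[of "Pair 0"] edge[of "Pair 1"] by (auto simp: dist_Pair_Pair image_subset_iff)
  then have PQ: "P 1 - P 0 = F (0, 1) - F (0, 0)" "Q 1 - Q 0 = F (1, 1) - F (1, 0)"
    using local_potential_increment_unique[OF P] local_potential_increment_unique[OF Q] by simp_all
  \<comment> \<open>On this side \<open>h\<close> stays at \<open>p c\<close> and
    \<open>g (p c) (p c) = 0\<close>, so the zero function is also a local potential there;
    uniqueness of increments compares it with \<open>F\<close>.\<close>
  have vert: "F (1, c) = F (0, c)" if c: "c = 0 \<or> c = 1" for c
  proof -
    have "h (0, c) \<in> topspace X"
      using c h' by (auto simp: continuous_map_def)
    then obtain W where "W \<in> \<U>" "p c \<in> W" using h0 cov by auto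
    then have z: "g (p c) (p c) = 0" by (rule cocycle_on_refl[OF g])
    have E: "local_potential g ?I (h \<circ> (\<lambda>s. (s, c))) (F \<circ> (\<lambda>s. (s, c)))"
      using c by (intro edge) (auto simp: dist_Pair_Pair)
    have "local_potential g ?I (h \<circ> (\<lambda>s. (s, c))) (\<lambda>_. 0)"
      unfolding local_potential_def using ends c z by (intro exI[of _ 1]) auto
    from local_potential_increment_unique[OF E this] show ?thesis by simp
  qed
  show ?thesis using PQ vert[of 0] vert[of 1] by simp
qed

section \<open>The global potential on a simply connected space\<close>

lemma pathin_joinpaths:
  assumes "pathin X p" "pathin X q" "p 1 = q 0"
  shows "pathin X (\<lambda>t. if t \<le> 1/2 then p (2 * t) else q (2 * t - 1))"
  unfolding pathin_def
proof (rule continuous_map_cases_le)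
  let ?T = "top_of_set {0..1::real}"
  have half: "continuous_map (subtopology ?T A) X (r \<circ> f)"
    if "pathin X r" "continuous_on UNIV f" "f ` ({0..1} \<inter> A) \<subseteq> {0..1}" for r A and f :: "real \<Rightarrow> real"
  proof (rule continuous_map_compose)
    show "continuous_map ?T X r" using that(1) by (simp add: pathin_def)
    show "continuous_map (subtopology ?T A) ?T f"
      using that(2,3) by (auto simp: subtopology_subtopology image_subset_iff
          intro: continuous_on_subset)
  qed
  show "continuous_map (subtopology ?T {t \<in> topspace ?T. t \<le> 1/2}) X (\<lambda>t. p (2 * t))"
    using half[OF assms(1), of "\<lambda>t. 2 * t" "{t \<in> topspace ?T. t \<le> 1/2}"]
    by (force simp: o_def intro!: continuous_intros)
  show "continuous_map (subtopology ?T {t \<in> topspace ?T. 1/2 \<le> t}) X (\<lambda>t. q (2 * t - 1))"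
    using half[OF assms(2), of "\<lambda>t. 2 * t - 1" "{t \<in> topspace ?T. 1/2 \<le> t}"]
    by (force simp: o_def intro!: continuous_intros)
  show "p (2 * t) = q (2 * t - 1)" if "t = 1/2" for t
    unfolding that using assms(3) by simp
qed (auto intro: continuous_map_from_subtopology)

text \<open>Inside a single member the cocycle identity holds at every scale, hence the arbitrary
  choice of 1 for \<open>\<epsilon>\<close>.\<close>

lemma local_potential_within:
  assumes g: "cocycle_on \<U> g" and W: "W \<in> \<U>" and p: "\<And>t. t \<in> S \<Longrightarrow> p t \<in> W" and a: "a \<in> W"
  shows "local_potential g S p (\<lambda>t. g a (p t))"
proof -
  have "g a (p t) - g a (p s) = g (p s) (p t)" if "s \<in> S" "t \<in> S" for s t
    using cocycle_onD[OF g W a p[OF that(1)] p[OF that(2)]] by (simp add: algebra_simps)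
  then show ?thesis unfolding local_potential_def by (intro exI[of _ 1]) auto
qed

text \<open>\<open>\<Phi> x\<close> is the increment along a chosen path from a base point to
  \<open>x\<close>. For \<open>x\<close> and \<open>y\<close> in \<open>W\<close>, that path
  followed by a path inside \<open>W\<close> is homotopic to the chosen path to \<open>y\<close>, so
  \<open>\<Phi> y - \<Phi> x\<close> is the increment inside \<open>W\<close>, namely
  \<open>g x y\<close>.\<close>

theorem simply_connected_cocycle_potential:
  assumes sc: "simply_connected_space X"
    and cov: "\<Union>\<U> = topspace X"
    and U: "\<And>U. U \<in> \<U> \<Longrightarrow> openin X U \<and> path_connectedin X U"
    and g: "cocycle_on \<U> g"
  obtains \<Phi> where "\<And>W x y. W \<in> \<U> \<Longrightarrow> x \<in> W \<Longrightarrow> y \<in> W \<Longrightarrow> \<Phi> y - \<Phi> x = g x y"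
proof (cases "topspace X = {}")
  case True
  then show ?thesis using cov by (intro that[of "\<lambda>_. 0"]) blast
next
  case False
  let ?I = "{0..1::real}"
  obtain b where b: "b \<in> topspace X" using False by blast
  have pot: "\<exists>F. local_potential g ?I p F" if "pathin X p" for p
    using that U by (intro local_potential_exists[OF _ _ _ cov _ g]) (auto simp: pathin_def)
  have "\<forall>x\<in>topspace X. \<exists>p F. pathin X p \<and> p 0 = b \<and> p 1 = x \<and> local_potential g ?I p F"
    using sc b pot unfolding simply_connected_space_def path_connected_space_def by meson
  then obtain p F where p: "\<And>x. x \<in> topspace X \<Longrightarrow> pathin X (p x) \<and> p x 0 = b \<and> p x 1 = x"
    and F: "\<And>x. x \<in> topspace X \<Longrightarrow> local_potential g ?I (p x) (F x)"
    by metis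
  show ?thesis
  proof (rule that[of "\<lambda>x. F x 1 - F x 0"])
    fix W x y assume W: "W \<in> \<U>" "x \<in> W" "y \<in> W"
    then have X: "x \<in> topspace X" "y \<in> topspace X" using cov by auto
    obtain q where q: "pathin X q" "q \<in> ?I \<rightarrow> W" "q 0 = x" "q 1 = y"
      using U[OF W(1)] W(2,3) unfolding path_connectedin by blast
    define r where "r = (\<lambda>t. if t \<le> 1/2 then p x (2 * t) else q (2 * t - 1))"
    have r: "pathin X r"
      unfolding r_def using p[OF X(1)] q by (intro pathin_joinpaths) auto
    then obtain R where R: "local_potential g ?I r R" using pot by blast
    have r01: "r 0 = p y 0" "r 1 = p y 1"
      using p[OF X(1)] p[OF X(2)] q by (auto simp: r_def)
    then have "homotopic_with (\<lambda>s. s 0 = r 0 \<and> s 1 = r 1) (top_of_set ?I) X r (p y)"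
      using sc r p[OF X(2)] unfolding simply_connected_space_def by blast
    then have Fy: "R 1 - R 0 = F y 1 - F y 0"
      using U by (intro local_potential_increment_homotopic[OF _ cov _ g R F[OF X(2)]]) auto
    \<comment> \<open>The first half of \<open>r\<close>, rescaled to the unit interval, is
      \<open>p x\<close>, so \<open>R\<close> gains there the same increment as
      \<open>F x\<close>.\<close>
    have "local_potential g ?I (r \<circ> (\<lambda>t. t / 2)) (R \<circ> (\<lambda>t. t / 2))"
      by (rule local_potential_compose[OF R]) (auto simp: dist_real_def)
    then have "local_potential g ?I (p x) (R \<circ> (\<lambda>t. t / 2))"
      unfolding local_potential_def by (auto simp: r_def)
    from local_potential_increment_unique[OF this F[OF X(1)]]
    have Fx: "R (1/2) - R 0 = F x 1 - F x 0" by simp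
    \<comment> \<open>At \<open>t = 0\<close> the argument \<open>1/2\<close> falls into the first
      branch of \<open>r\<close>; there \<open>p x 1 = x = q 0\<close> is needed.\<close>
    have r2: "r ((1 + t) / 2) = q t" if "t \<in> ?I" for t
      using that p[OF X(1)] q(3) by (cases "t = 0") (auto simp: r_def field_simps)
    have "local_potential g ?I (r \<circ> (\<lambda>t. (1 + t) / 2)) (R \<circ> (\<lambda>t. (1 + t) / 2))"
      by (rule local_potential_compose[OF R]) (auto simp: dist_real_def abs_if divide_simps)
    then have Rq: "local_potential g ?I q (R \<circ> (\<lambda>t. (1 + t) / 2))"
      unfolding local_potential_def by (auto simp: r2)
    have "local_potential g ?I q (\<lambda>t. g x (q t))"
      using q(2) W by (intro local_potential_within[OF g W(1)]) auto
    from local_potential_increment_unique[OF Rq this]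
    have "R 1 - R (1/2) = g x y - g x x" using q(3,4) by simp
    then have "R 1 - R (1/2) = g x y" using cocycle_on_refl[OF g W(1,2)] by simp
    moreover have "(R 1 - R 0) - (R (1/2) - R 0) = R 1 - R (1/2)" by simp
    ultimately show "(F y 1 - F y 0) - (F x 1 - F x 0) = g x y"
      by (simp only: Fx Fy)
  qed
qed

section \<open>From couplings to cocycles on points and back\<close>

theorem simply_connected_coupling_primitive:
  fixes d :: "'a set \<times> 'a set \<Rightarrow> 'k::ab_group_add"
  assumes sc: "simply_connected_space X"
    and cov: "\<Union>\<U> = topspace X"
    and U: "\<And>U. U \<in> \<U> \<Longrightarrow> openin X U \<and> path_connectedin X U"
    and anti: "antisymmetric_coupling \<U> d" and add: "additive_coupling \<U> d"
  shows "\<exists>C. is_primitive \<U> d C"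
proof -
  have anti: "d (V, W) = - d (W, V)" if "V \<in> \<U>" "W \<in> \<U>" "x \<in> V" "x \<in> W" for V W x
    using anti that unfolding antisymmetric_coupling_def overlaps_def by blast
  have add: "d (V, W) = d (V, V') + d (V', W)"
    if "V \<in> \<U>" "V' \<in> \<U>" "W \<in> \<U>" "x \<in> V" "x \<in> V'" "x \<in> W" for V V' W x
    using add that unfolding additive_coupling_def by blast
  \<comment> \<open>Each point gets a reference member \<open>u x\<close>; \<open>g x y\<close> is
    then the coupling from \<open>u x\<close> to \<open>u y\<close> routed through a common member
    of \<open>x\<close> and \<open>y\<close>.\<close>
  define u where "u x = (SOME V. V \<in> \<U> \<and> x \<in> V)" for x
  have u: "u x \<in> \<U>" "x \<in> u x" if "W \<in> \<U>" "x \<in> W" for W x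
    using someI[of "\<lambda>V. V \<in> \<U> \<and> x \<in> V" W] that by (auto simp: u_def)
  define w where "w x y = (SOME V. V \<in> \<U> \<and> x \<in> V \<and> y \<in> V)" for x y
  define g where "g x y = d (u x, w x y) + d (w x y, u y)" for x y
  \<comment> \<open>The route does not matter: additivity at \<open>x\<close> and at
    \<open>y\<close> replaces \<open>?V\<close> by \<open>W\<close>, inserting the same
    \<open>d (?V, W)\<close> in both expansions.\<close>
  have g_eq: "g x y = d (u x, W) + d (W, u y)" if W: "W \<in> \<U>" "x \<in> W" "y \<in> W" for W x y
  proof -
    let ?V = "w x y"
    have V: "?V \<in> \<U>" "x \<in> ?V" "y \<in> ?V"
      using someI[of "\<lambda>V. V \<in> \<U> \<and> x \<in> V \<and> y \<in> V" W] W by (auto simp: w_def)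
    have "d (u x, W) = d (u x, ?V) + d (?V, W)" using V W u by (intro add[where x = x]) auto
    moreover have "d (?V, u y) = d (?V, W) + d (W, u y)" using V W u by (intro add[where x = y]) auto
    ultimately show ?thesis by (simp add: g_def)
  qed
  have "cocycle_on \<U> g"
    unfolding cocycle_on_def
  proof (intro ballI)
    fix W x y z assume W: "W \<in> \<U>" "x \<in> W" "y \<in> W" "z \<in> W"
    \<comment> \<open>With all three values routed through \<open>W\<close>, the two terms between
      \<open>W\<close> and \<open>u y\<close> cancel.\<close>
    have "d (W, u y) = - d (u y, W)" using W u by (intro anti[where x = y]) auto
    with W show "g x y + g y z = g x z" by (simp add: g_eq)
  qed
  then obtain \<Phi> where \<Phi>: "\<And>W x y. W \<in> \<U> \<Longrightarrow> x \<in> W \<Longrightarrow> y \<in> W \<Longrightarrow> \<Phi> y - \<Phi> x = g x y"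
    using simply_connected_cocycle_potential[OF sc cov U] by metis
  \<comment> \<open>The potential at a point of \<open>W\<close> is corrected by the coupling from
    the reference member to \<open>W\<close>; \<open>C\<close> below shows that the point does not
    matter. For empty \<open>W\<close> the value is arbitrary, since such a \<open>W\<close>
    overlaps nothing.\<close>
  define C where "C W = (let x = SOME x. x \<in> W in \<Phi> x + d (u x, W))" for W
  have C: "C W = \<Phi> x + d (u x, W)" if W: "W \<in> \<U>" "x \<in> W" for W x
  proof -
    define y where "y = (SOME y. y \<in> W)"
    have y: "y \<in> W" using W(2) unfolding y_def by (rule someI)
    have "\<Phi> y - \<Phi> x = d (u x, W) + d (W, u y)" using \<Phi>[OF W y] g_eq[OF W y] by simp
    moreover have "d (W, u y) = - d (u y, W)" using W y u by (intro anti[where x = y]) auto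
    ultimately have "\<Phi> y + d (u y, W) = \<Phi> x + d (u x, W)" by (simp add: algebra_simps)
    then show ?thesis by (simp add: C_def y_def Let_def)
  qed
  have "d (V, W) = C W - C V" if VW: "V \<in> \<U>" "W \<in> \<U>" "x \<in> V" "x \<in> W" for V W x
  \<comment> \<open>At a common point \<open>x\<close> the terms \<open>\<Phi> x\<close> cancel in
    \<open>C W - C V\<close>, and additivity at \<open>x\<close> leaves
    \<open>d (V, W)\<close>.\<close>
  proof -
    have "d (u x, W) = d (u x, V) + d (V, W)" using VW u by (intro add[where x = x]) auto
    then show ?thesis using C[OF VW(1,3)] C[OF VW(2,4)] by simp
  qed
  then have "is_primitive \<U> d C" unfolding is_primitive_def overlaps_def by blast
  then show ?thesis by blast
qed

theorem theorem1p1: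
  fixes \<Omega> :: "'a topology" and \<U> :: "'a set set"
  assumes "simply_connected_space \<Omega>"
    and "\<Union>\<U> = topspace \<Omega>"
    and "\<And>U. U \<in> \<U> \<Longrightarrow> openin \<Omega> U \<and> path_connectedin \<Omega> U"
  shows "(\<forall>d :: 'a set \<times> 'a set \<Rightarrow> real.
            antisymmetric_coupling \<U> d \<and> additive_coupling \<U> d \<longrightarrow> (\<exists>C. is_primitive \<U> d C)) \<and>
         (\<forall>d :: 'a set \<times> 'a set \<Rightarrow> complex.
            antisymmetric_coupling \<U> d \<and> additive_coupling \<U> d \<longrightarrow> (\<exists>C. is_primitive \<U> d C))"
  \<comment> \<open>The result for abelian groups is instantiated at both possible fields.\<close>
  using simply_connected_coupling_primitive[OF assms(1,2), where 'k = real]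
    simply_connected_coupling_primitive[OF assms(1,2), where 'k = complex] assms(3)
  by simp

end
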